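(* Let $(X,\delta,m)$ be a cell complex, let $k\in\mathbb{N}=\{1,2,\dots\}$ and $R\in\mathbb{R}$. The following statements are equivalent: (i) $F(x)\ge R$ for all $x\in X_k$; (ii) $\|e^{-tH}f\|_\infty\le e^{-Rt}\|f\|_\infty$ for all $f\in C(X_k)$ and all $t\ge0$; (iii) $\|e^{-tH}f\|_p\le e^{-Rt}\|f\|_p$ for all $f\in C(X_k)$, all $p\in[1,\infty]$ and all $t\ge 0$; (iv) $H_k-R$ is diagonally dominant and non-negative, where $H_k=H|_{C(X_k)}$.
   Context: For a finite set $X$, $C(X)=\mathbb{R}^X$, and $x\in X$ is identified with its indicator function $1_x\in C(X)$. A cell complex $K=(X,\delta,m)$ consists of a finite set of cells $X=\dot\bigcup_{k\ge 0}X_k$, a linear operator $\delta:C(X)\to C(X)$ (coboundary) and a weight $m:X\to(0,\infty)$. Write $\dim(z)=k$ iff $z\in X_k$, and $x\lessdot z$ (equivalently $z\gtrdot x$) iff $\delta x(z)\ne 0$. It is required that for all $v,z,z'\in X$: $\delta v(z)\in\{-1,0,1\}$; $\delta v(z)=0$ if $\dim(z)-\dim(v)\ne 1$; if $\dim(z)\ge 1$ there exists $x\lessdot z$; and (i) for every $x\in X_1$ there is exactly one $w\in X_0$ with $\delta w(x)=1$ and exactly one $w\in X_0$ with $\delta w(x)=-1$; (ii) if $\dim(z)-\dim(v)=2$ and $\{x:v\lessdot x\lessdot z\}\ne\emptyset$, then $|\{x:v\lessdot x\lessdot z\}|=2$ and $\{\delta v(x)\,\delta x(z):x\in X\}\supseteq\{-1,1\}$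 (hence $\delta\delta=0$); (iii) for all $x,y\lessdot z$ there is a sequence $(x=x_0,\dots,x_n=y)$ of cells with $\delta x_i(x_{i-1})+\delta x_{i-1}(x_i)\ne0$ for all $i=1,\dots,n$; (iv) if $\{x:x\lessdot z\}=\{x:x\lessdot z'\}$ and $\dim(z)\ge 1$, then $z=z'$. $C(X)$ carries the scalar product $\langle f,g\rangle=\sum_{x\in X}f(x)g(x)m(x)$, $\delta^*$ is the adjoint of $\delta$, and $H=\delta\delta^*+\delta^*\delta$ is the Hodge Laplacian; $H$ maps $C(X_k)$ to $C(X_k)$. The Forman curvature of $x\in X$ is $F(x)=Hx(x)-\sum_{y\ne x}|Hy(x)|$. Norms: $\|f\|_p^p=\sum_x m(x)|f(x)|^p$ for $p\in[1,\infty)$ and $\|f\|_\infty=\max_x|f(x)|$. A selfadjoint operator $A$ on $C(Y)$ (with respect to the scalar product weighted by $m$; $Y$ finite) is called diagonally dominant (and non-negative) if $Ax(x)\ge\sum_{y\ne x}|Ay(x)|$ for all $x\in Y$. *)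

theory Defs
  imports "HOL-Analysis.Analysis"
begin

text \<open>
  The finite set of cells is a type \<open>'a\<close> of class \<open>finite\<close>, so that
  \<open>C(X)\<close> is \<open>real ^ 'a\<close>. The partition of the cells by dimension is given by a function
  \<open>cdim :: 'a \<Rightarrow> nat\<close>, with \<open>X\<^sub>k = cells cdim k\<close>. For a set \<open>Y\<close> of cells, \<open>C(Y)\<close> is identified
  with the subspace \<open>funs_on Y\<close> of functions vanishing off \<open>Y\<close>.
\<close>

abbreviation ind :: "'a::finite \<Rightarrow> real ^ 'a" where
  "ind x \<equiv> axis x 1"

definition cells :: "('a \<Rightarrow> nat) \<Rightarrow> nat \<Rightarrow> 'a set" where
  "cells cdim k = {x. cdim x = k}"

definition funs_on :: "'a::finite set \<Rightarrow> (real ^ 'a) set" where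
  "funs_on Y = {f. \<forall>x. x \<notin> Y \<longrightarrow> f $ x = 0}"

definition is_face :: "(real ^ 'a \<Rightarrow> real ^ 'a) \<Rightarrow> 'a::finite \<Rightarrow> 'a \<Rightarrow> bool" where
  "is_face \<delta> x z \<longleftrightarrow> \<delta> (ind x) $ z \<noteq> 0"

locale cell_complex =
  fixes cdim :: "'a::finite \<Rightarrow> nat"
    and \<delta> :: "real ^ 'a \<Rightarrow> real ^ 'a"
    and m :: "'a \<Rightarrow> real"
  assumes weight_pos: "0 < m x"
    and linear_coboundary: "linear \<delta>"
    and incidence_values: "\<delta> (ind v) $ z \<in> {-1, 0, 1}"
    and incidence_dim: "int (cdim z) - int (cdim v) \<noteq> 1 \<Longrightarrow> \<delta> (ind v) $ z = 0"
    and has_face: "cdim z \<ge> 1 \<Longrightarrow> \<exists>x. is_face \<delta> x z"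
    and edge_endpoints: "x \<in> cells cdim 1 \<Longrightarrow>
          (\<exists>!w. w \<in> cells cdim 0 \<and> \<delta> (ind w) $ x = 1) \<and>
          (\<exists>!w. w \<in> cells cdim 0 \<and> \<delta> (ind w) $ x = -1)"
    and diamond: "\<lbrakk>int (cdim z) - int (cdim v) = 2; {x. is_face \<delta> v x \<and> is_face \<delta> x z} \<noteq> {}\<rbrakk> \<Longrightarrow>
          card {x. is_face \<delta> v x \<and> is_face \<delta> x z} = 2 \<and>
          {-1, 1} \<subseteq> {\<delta> (ind v) $ x * \<delta> (ind x) $ z | x. True}"
    and faces_connected: "\<lbrakk>is_face \<delta> x z; is_face \<delta> y z\<rbrakk> \<Longrightarrow>
          \<exists>(n::nat) (s :: nat \<Rightarrow> 'a). s 0 = x \<and> s n = y \<and>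
            (\<forall>i\<in>{1..n}. \<delta> (ind (s i)) $ s (i - 1) + \<delta> (ind (s (i - 1))) $ s i \<noteq> 0)"
    and faces_determine: "\<lbrakk>{x. is_face \<delta> x z} = {x. is_face \<delta> x z'}; cdim z \<ge> 1\<rbrakk> \<Longrightarrow> z = z'"

definition weighted_inner :: "('a \<Rightarrow> real) \<Rightarrow> real ^ 'a::finite \<Rightarrow> real ^ 'a \<Rightarrow> real" where
  "weighted_inner m f g = (\<Sum>x\<in>UNIV. f $ x * g $ x * m x)"

text \<open>
  The library constant \<^const>\<open>adjoint\<close> refers to the unweighted inner product; this is the same
  definition for the weighted one.
\<close>

definition weighted_adjoint ::
    "('a \<Rightarrow> real) \<Rightarrow> (real ^ 'a \<Rightarrow> real ^ 'a) \<Rightarrow> real ^ 'a::finite \<Rightarrow> real ^ 'a" where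
  "weighted_adjoint m A = (SOME B. \<forall>f g. weighted_inner m (A f) g = weighted_inner m f (B g))"

lemma weighted_adjoint_works:
  fixes A :: "real ^ 'a::finite \<Rightarrow> real ^ 'a"
  assumes "linear A" and m: "\<And>x. 0 < m x"
  shows "weighted_inner m (A f) g = weighted_inner m f (weighted_adjoint m A g)"
proof -
  define B :: "real ^ 'a \<Rightarrow> real ^ 'a" where
    "B g = (\<chi> x. adjoint A (\<chi> y. g $ y * m y) $ x / m x)" for g
  have "weighted_inner m (A f) g = weighted_inner m f (B g)" for f g
  proof -
    have "weighted_inner m (A f) g = A f \<bullet> (\<chi> y. g $ y * m y)"
      by (simp add: weighted_inner_def inner_vec_def mult.assoc)
    also have "\<dots> = f \<bullet> adjoint A (\<chi> y. g $ y * m y)"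
      using adjoint_works[OF \<open>linear A\<close>] by (simp add: inner_commute)
    also have "\<dots> = weighted_inner m f (B g)"
      using m by (simp add: weighted_inner_def inner_vec_def B_def less_imp_neq[symmetric])
    finally show ?thesis .
  qed
  then have "\<exists>B. \<forall>f g. weighted_inner m (A f) g = weighted_inner m f (B g)"
    by blast
  from someI_ex[OF this] show ?thesis
    unfolding weighted_adjoint_def by blast
qed

definition hodge_laplacian ::
    "(real ^ 'a \<Rightarrow> real ^ 'a) \<Rightarrow> ('a \<Rightarrow> real) \<Rightarrow> real ^ 'a::finite \<Rightarrow> real ^ 'a" where
  "hodge_laplacian \<delta> m f = \<delta> (weighted_adjoint m \<delta> f) + weighted_adjoint m \<delta> (\<delta> f)"

definition forman_curvature ::
    "(real ^ 'a \<Rightarrow> real ^ 'a) \<Rightarrow> ('a \<Rightarrow> real) \<Rightarrow> 'a::finite \<Rightarrow> real" where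
  "forman_curvature \<delta> m x =
     hodge_laplacian \<delta> m (ind x) $ x - (\<Sum>y\<in>UNIV - {x}. \<bar>hodge_laplacian \<delta> m (ind y) $ x\<bar>)"

text \<open>
  The exponential \<open>e\<^sup>A\<close> of a linear operator. The library's \<^const>\<open>exp\<close> is not available, since linear
  operators are not an instance of a normed algebra whose product is composition.
\<close>

definition op_exp :: "(real ^ 'a \<Rightarrow> real ^ 'a) \<Rightarrow> real ^ 'a::finite \<Rightarrow> real ^ 'a" where
  "op_exp A f = (\<Sum>n. (A ^^ n) f /\<^sub>R fact n)"

lemma op_exp_sums:
  fixes A :: "real ^ 'a::finite \<Rightarrow> real ^ 'a"
  assumes "linear A"
  shows "(\<lambda>n. (A ^^ n) f /\<^sub>R fact n) sums op_exp A f"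
proof -
  from assms obtain B where B: "\<And>x. norm (A x) \<le> B * norm x" "0 < B"
    using linear_bounded_pos by blast
  have bound: "norm ((A ^^ n) f) \<le> B ^ n * norm f" for n
  proof (induction n)
    case (Suc n)
    have "norm ((A ^^ Suc n) f) \<le> B * norm ((A ^^ n) f)"
      using B by simp
    also have "\<dots> \<le> B * (B ^ n * norm f)"
      using Suc B by (intro mult_left_mono) auto
    finally show ?case by (simp add: mult.assoc)
  qed simp
  have "summable (\<lambda>n. (B ^ n /\<^sub>R fact n) * norm f)"
    by (intro summable_mult2 summable_exp_generic)
  then have "summable (\<lambda>n. (A ^^ n) f /\<^sub>R fact n)"
  proof (rule summable_comparison_test')
    fix n
    show "norm ((A ^^ n) f /\<^sub>R fact n) \<le> (B ^ n /\<^sub>R fact n) * norm f"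
      using bound[of n] by (simp add: divide_simps)
  qed
  then show ?thesis
    unfolding op_exp_def by (rule summable_sums)
qed

text \<open>Note that the norm for \<open>p = \<infinity>\<close> does not involve the weight.\<close>

definition lp_norm :: "('a \<Rightarrow> real) \<Rightarrow> ereal \<Rightarrow> real ^ 'a::finite \<Rightarrow> real" where
  "lp_norm m p f =
     (if p = \<infinity> then Max (range (\<lambda>x. \<bar>f $ x\<bar>))
      else (\<Sum>x\<in>UNIV. m x * \<bar>f $ x\<bar> powr real_of_ereal p) powr (1 / real_of_ereal p))"

text \<open>
  Operators on \<open>C(Y)\<close> are given by functions on the whole space of which only the restriction
  to \<^term>\<open>funs_on Y\<close> is considered.
\<close>

definition selfadjoint_on ::
    "('a \<Rightarrow> real) \<Rightarrow> 'a::finite set \<Rightarrow> (real ^ 'a \<Rightarrow> real ^ 'a) \<Rightarrow> bool" where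
  "selfadjoint_on m Y A \<longleftrightarrow>
     (\<forall>f\<in>funs_on Y. A f \<in> funs_on Y) \<and>
     (\<forall>f\<in>funs_on Y. \<forall>g\<in>funs_on Y. A (f + g) = A f + A g) \<and>
     (\<forall>f\<in>funs_on Y. \<forall>c. A (c *\<^sub>R f) = c *\<^sub>R A f) \<and>
     (\<forall>f\<in>funs_on Y. \<forall>g\<in>funs_on Y. weighted_inner m (A f) g = weighted_inner m f (A g))"

definition diagonally_dominant_on ::
    "('a \<Rightarrow> real) \<Rightarrow> 'a::finite set \<Rightarrow> (real ^ 'a \<Rightarrow> real ^ 'a) \<Rightarrow> bool" where
  "diagonally_dominant_on m Y A \<longleftrightarrow>
     selfadjoint_on m Y A \<and> (\<forall>x\<in>Y. (\<Sum>y\<in>Y - {x}. \<bar>A (ind y) $ x\<bar>) \<le> A (ind x) $ x)"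

end

theory Submission
  imports Defs
begin

text \<open>
  Dominance of row \<open>x\<close> says exactly that \<open>c - H\<close> with large \<open>c\<close> has supremum norm at most \<open>c - R\<close>, so
  \<open>exp (- t H) = exp (- t c) exp (t (c - H))\<close> has supremum norm at most \<open>exp (- R t)\<close>. Conversely, the
  supremum contraction is differentiated at \<open>t = 0\<close> on the sign pattern of a row of \<open>H\<close>. Finally,
  the kernel of \<open>exp (- t H)\<close> is symmetric with respect to \<open>m\<close>, so that a bound on its row sums is also
  one on its weighted column sums, and Jensen's inequality gives the contraction for every \<open>p\<close>.
\<close>

subsection \<open>Exponentials of linear operators\<close>

lemma linear_nth_expand:
  fixes A :: "real ^ 'a::finite \<Rightarrow> real ^ 'a"
  assumes "linear A"
  shows "A f $ x = (\<Sum>y\<in>UNIV. A (ind y) $ x * f $ y)"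
proof -
  have "A f = A (\<Sum>y\<in>UNIV. f $ y *\<^sub>R ind y)"
    using basis_expansion[of f] by (simp add: scalar_mult_eq_scaleR)
  also have "\<dots> = (\<Sum>y\<in>UNIV. f $ y *\<^sub>R A (ind y))"
    by (simp add: linear_sum[OF assms] linear_cmul[OF assms])
  finally show ?thesis by (simp add: mult.commute)
qed

lemma linear_funpow:
  fixes A :: "'a::real_vector \<Rightarrow> 'a"
  assumes "linear A"
  shows "linear (A ^^ n)"
proof (induction n)
  case 0
  show ?case using linear_ident by (simp add: id_def)
next
  case (Suc n)
  then show ?case using linear_compose[OF Suc assms] by (simp add: o_def)
qed

lemma funpow_scaleR:
  fixes A :: "'a::real_vector \<Rightarrow> 'a"
  assumes "linear A"
  shows "((\<lambda>g. t *\<^sub>R A g) ^^ n) f = t ^ n *\<^sub>R (A ^^ n) f"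
  by (induction n) (auto simp: linear_cmul[OF assms])

lemma op_exp_nth_sums:
  fixes A :: "real ^ 'a::finite \<Rightarrow> real ^ 'a"
  assumes "linear A"
  shows "(\<lambda>n. (A ^^ n) f $ x / fact n) sums (op_exp A f $ x)"
  using bounded_linear.sums[OF bounded_linear_vec_nth op_exp_sums[OF assms]]
  by (simp add: divide_inverse mult.commute)

text \<open>Makes each coordinate of \<open>op_exp (t A) f\<close> an everywhere convergent real
  power series in \<open>t\<close>, which can then be differentiated at 0.\<close>

lemma op_exp_scaleR_nth_sums:
  fixes A :: "real ^ 'a::finite \<Rightarrow> real ^ 'a"
  assumes "linear A"
  shows "(\<lambda>n. (A ^^ n) f $ x / fact n * t ^ n) sums (op_exp (\<lambda>g. t *\<^sub>R A g) f $ x)"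
  using op_exp_nth_sums[OF linear_compose_scale_right[OF assms], of t f x]
  by (simp add: funpow_scaleR[OF assms] mult.commute)

text \<open>The power series in \<open>t\<close> converges at \<open>t = 2\<close>, hence absolutely
  at the smaller point \<open>t = 1\<close>.\<close>

lemma summable_norm_op_exp_nth:
  fixes A :: "real ^ 'a::finite \<Rightarrow> real ^ 'a"
  assumes "linear A"
  shows "summable (\<lambda>n. norm ((A ^^ n) f $ x / fact n))"
  using powser_insidea[OF sums_summable[OF op_exp_scaleR_nth_sums[OF assms, of f x 2]], of 1]
  by simp

lemma linear_op_exp:
  fixes A :: "real ^ 'a::finite \<Rightarrow> real ^ 'a"
  assumes "linear A"
  shows "linear (op_exp A)"
proof
  have lin: "linear (A ^^ n)" for n by (rule linear_funpow[OF assms])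
  fix f g and c :: real
  show "op_exp A (f + g) = op_exp A f + op_exp A g"
    using sums_add[OF op_exp_sums[OF assms, of f] op_exp_sums[OF assms, of g]]
      op_exp_sums[OF assms, of "f + g"]
    by (simp add: linear_add[OF lin] scaleR_add_right sums_iff)
  show "op_exp A (c *\<^sub>R f) = c *\<^sub>R op_exp A f"
    using sums_scaleR_right[OF op_exp_sums[OF assms, of f], of c]
      op_exp_sums[OF assms, of "c *\<^sub>R f"]
    by (simp add: linear_cmul[OF lin] mult.commute sums_iff)
qed

text \<open>The identity commutes with \<open>A\<close>, so the series of \<open>c + A\<close> is
  the Cauchy product of the two exponential series. Instead of expanding binomially, the proof shows
  that the terms of that product obey the recursion \<open>(n + 1) p (n + 1) = D (p n)\<close> that
  the terms of the exponential series of \<open>D\<close> satisfy.\<close>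

lemma op_exp_add_scaleR:
  fixes A :: "real ^ 'a::finite \<Rightarrow> real ^ 'a"
  assumes "linear A"
  shows "op_exp (\<lambda>g. c *\<^sub>R g + A g) f = exp c *\<^sub>R op_exp A f"
proof (rule vec_eq_iff[THEN iffD2, rule_format])
  fix x
  define D where "D = (\<lambda>g. c *\<^sub>R g + A g)"
  have "linear D"
    unfolding D_def by (intro linear_compose_add assms linear_compose_scale_right linear_ident)
  define e where "e i = c ^ i / fact i" for i
  define u where "u i = (A ^^ i) f /\<^sub>R fact i" for i
  have e_Suc: "real (Suc i) * e (Suc i) = c * e i" for i
    by (simp add: e_def divide_simps)
  have u_Suc: "real (Suc i) *\<^sub>R u (Suc i) = A (u i)" for i
    by (simp add: u_def linear_cmul[OF assms] divide_simps flip: of_nat_Suc)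
  \<comment> \<open>A discrete Leibniz rule: the factor \<open>Suc n\<close> is split as
    \<open>i + (Suc n - i)\<close>, the first part lowering the index of \<open>e\<close> and the
    second that of \<open>u\<close>.\<close>
  have step: "real (Suc n) *\<^sub>R (\<Sum>i\<le>Suc n. e i *\<^sub>R u (Suc n - i)) = D (\<Sum>i\<le>n. e i *\<^sub>R u (n - i))"
    for n
  proof -
    have "real (Suc n) *\<^sub>R (\<Sum>i\<le>Suc n. e i *\<^sub>R u (Suc n - i)) =
        (\<Sum>i\<le>Suc n. (real i * e i) *\<^sub>R u (Suc n - i)) +
        (\<Sum>i\<le>Suc n. e i *\<^sub>R (real (Suc n - i) *\<^sub>R u (Suc n - i)))"
      unfolding scaleR_sum_right sum.distrib[symmetric]
      by (intro sum.cong refl) (auto simp: of_nat_diff algebra_simps)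
    \<comment> \<open>The term \<open>i = 0\<close> vanishes here; in the other sum it is the term
      \<open>i = Suc n\<close>. So both range over \<open>i \<le> n\<close> after
      reindexing.\<close>
    also have "(\<Sum>i\<le>Suc n. (real i * e i) *\<^sub>R u (Suc n - i)) = c *\<^sub>R (\<Sum>i\<le>n. e i *\<^sub>R u (n - i))"
      unfolding sum.atMost_Suc_shift e_Suc by (simp add: scaleR_sum_right)
    also have "(\<Sum>i\<le>Suc n. e i *\<^sub>R (real (Suc n - i) *\<^sub>R u (Suc n - i))) =
        (\<Sum>i\<le>n. e i *\<^sub>R A (u (n - i)))"
      unfolding sum.atMost_Suc
      by (simp add: Suc_diff_le u_Suc del: of_nat_Suc cong: sum.cong_simp)
    also have "\<dots> = A (\<Sum>i\<le>n. e i *\<^sub>R u (n - i))"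
      by (simp add: linear_sum[OF assms] linear_cmul[OF assms])
    finally show ?thesis by (simp add: D_def)
  qed
  have powers: "(D ^^ n) f /\<^sub>R fact n = (\<Sum>i\<le>n. e i *\<^sub>R u (n - i))" for n
  proof (induction n)
    case 0
    show ?case by (simp add: e_def u_def)
  next
    case (Suc n)
    have "(D ^^ Suc n) f /\<^sub>R fact (Suc n) = D ((D ^^ n) f /\<^sub>R fact n) /\<^sub>R real (Suc n)"
      by (simp add: linear_cmul[OF \<open>linear D\<close>] mult.commute)
    also have "\<dots> = (\<Sum>i\<le>Suc n. e i *\<^sub>R u (Suc n - i))"
      unfolding Suc step[symmetric] by simp
    finally show ?case .
  qed
  have "e sums exp c"
    using exp_converges[of c] by (simp add: e_def[abs_def] divide_inverse mult.commute)
  moreover have u_eq: "u i $ x = (A ^^ i) f $ x / fact i" for i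
    by (simp add: u_def divide_inverse mult.commute)
  moreover have "summable (\<lambda>i. norm (e i))"
    using summable_norm_exp[of c] by (simp add: e_def[abs_def] divide_inverse mult.commute)
  \<comment> \<open>Passing to the coordinate \<open>x\<close> makes this a product of two
    absolutely convergent real series.\<close>
  ultimately have "(\<lambda>n. \<Sum>i\<le>n. e i * u (n - i) $ x) sums (exp c * op_exp A f $ x)"
    using Cauchy_product_sums[of e "\<lambda>i. u i $ x"] summable_norm_op_exp_nth[OF assms, of f x]
      op_exp_nth_sums[OF assms, of f x]
    by (simp add: sums_iff)
  moreover have "(D ^^ n) f $ x / fact n = (\<Sum>i\<le>n. e i * u (n - i) $ x)" for n
    using arg_cong[OF powers[of n], of "\<lambda>g. g $ x"] by (simp add: divide_inverse mult.commute)
  ultimately show "op_exp (\<lambda>g. c *\<^sub>R g + A g) f $ x = (exp c *\<^sub>R op_exp A f) $ x"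
    using op_exp_nth_sums[OF \<open>linear D\<close>, of f x] by (simp add: sums_iff D_def)
qed


subsection \<open>Symmetric kernels and weighted norms\<close>

text \<open>Jensen's inequality for the weights \<open>a y / S\<close>, where \<open>S\<close> is
  their total. Undoing the normalisation costs \<open>S powr p / S\<close>, which is at most
  \<open>q powr (p - 1)\<close> because \<open>p \<ge> 1\<close>.\<close>

lemma powr_weighted_sum_le:
  fixes a g :: "'a \<Rightarrow> real"
  assumes "finite Y" "p \<ge> 1" "\<And>y. y \<in> Y \<Longrightarrow> 0 \<le> a y" "\<And>y. y \<in> Y \<Longrightarrow> 0 \<le> g y"
    and q: "(\<Sum>y\<in>Y. a y) \<le> q"
  shows "(\<Sum>y\<in>Y. a y * g y) powr p \<le> q powr (p - 1) * (\<Sum>y\<in>Y. a y * g y powr p)"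
proof -
  \<comment> \<open>The library has convexity of \<^term>\<open>\<lambda>x. x powr p\<close> only on the open half line.\<close>
  define T where "T = {y\<in>Y. 0 < a y \<and> 0 < g y}"
  define S where "S = (\<Sum>y\<in>T. a y)"
  have T: "finite T" "T \<subseteq> Y" using \<open>finite Y\<close> by (auto simp: T_def)
  have zero: "a y = 0 \<or> g y = 0" if "y \<in> Y - T" for y
    using that assms(3,4)[of y] by (auto simp: T_def)
  have sum_T: "(\<Sum>y\<in>Y. a y * g y) = (\<Sum>y\<in>T. a y * g y)"
    "(\<Sum>y\<in>Y. a y * g y powr p) = (\<Sum>y\<in>T. a y * g y powr p)"
    using T \<open>finite Y\<close> zero by (auto intro!: sum.mono_neutral_right)
  have nonneg: "0 \<le> (\<Sum>y\<in>T. a y * g y powr p)"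
    by (intro sum_nonneg) (auto simp: T_def)
  show ?thesis
  proof (cases "T = {}")
    case True
    then show ?thesis by (simp add: sum_T)
  next
    case False
    then have "0 < S" unfolding S_def using T by (intro sum_pos) (auto simp: T_def)
    have "S \<le> q"
      unfolding S_def using T \<open>finite Y\<close> assms(3) q
      by (intro order.trans[OF sum_mono2 q]) auto
    have "(\<Sum>y\<in>T. a y * g y) powr p = (S * (\<Sum>y\<in>T. a y / S * g y)) powr p"
      using \<open>0 < S\<close> by (simp add: sum_distrib_left)
    also have "\<dots> = S powr p * (\<Sum>y\<in>T. a y / S * g y) powr p"
      using \<open>0 < S\<close> by (intro powr_mult)
    also have "(\<Sum>y\<in>T. a y / S * g y) powr p \<le> (\<Sum>y\<in>T. a y / S * g y powr p)"
      using convex_on_sum[OF \<open>finite T\<close> False powr_convex[OF \<open>p \<ge> 1\<close>], of "\<lambda>y. a y / S" g] \<open>0 < S\<close>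
      by (auto simp: T_def S_def simp flip: sum_divide_distrib)
    also have "S powr p * (\<Sum>y\<in>T. a y / S * g y powr p) = S powr (p - 1) * (\<Sum>y\<in>T. a y * g y powr p)"
      using \<open>0 < S\<close> by (simp add: sum_distrib_left powr_diff)
    also have "\<dots> \<le> q powr (p - 1) * (\<Sum>y\<in>T. a y * g y powr p)"
      using \<open>0 < S\<close> \<open>S \<le> q\<close> \<open>p \<ge> 1\<close> nonneg by (intro mult_right_mono powr_mono2) auto
    finally show ?thesis using \<open>0 < S\<close> by (simp add: sum_T mult_left_mono)
  qed
qed

text \<open>A Schur test. Jensen in each row yields \<open>q powr (p - 1)\<close>; the missing
  factor \<open>q\<close> is a bound on the weighted column sums, which symmetry turns back into row
  sums.\<close>

lemma symmetric_kernel_powr_le: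
  fixes K :: "'a \<Rightarrow> 'a \<Rightarrow> real" and m f :: "'a \<Rightarrow> real"
  assumes "finite Y" "p \<ge> 1" "q > 0"
    and m: "\<And>x. x \<in> Y \<Longrightarrow> 0 < m x"
    and sym: "\<And>x y. x \<in> Y \<Longrightarrow> y \<in> Y \<Longrightarrow> m x * K x y = m y * K y x"
    and rows: "\<And>x. x \<in> Y \<Longrightarrow> (\<Sum>y\<in>Y. \<bar>K x y\<bar>) \<le> q"
  shows "(\<Sum>x\<in>Y. m x * \<bar>\<Sum>y\<in>Y. K x y * f y\<bar> powr p) \<le> q powr p * (\<Sum>y\<in>Y. m y * \<bar>f y\<bar> powr p)"
proof -
  have abs_sym: "m x * \<bar>K x y\<bar> = m y * \<bar>K y x\<bar>" if "x \<in> Y" "y \<in> Y" for x y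
    using arg_cong[OF sym[OF that], of abs] m[of x] m[of y] that by (simp add: abs_mult)
  have "(\<Sum>x\<in>Y. m x * \<bar>\<Sum>y\<in>Y. K x y * f y\<bar> powr p)
      \<le> (\<Sum>x\<in>Y. m x * (q powr (p - 1) * (\<Sum>y\<in>Y. \<bar>K x y\<bar> * \<bar>f y\<bar> powr p)))"
  proof (intro sum_mono mult_left_mono)
    fix x assume "x \<in> Y"
    show "0 \<le> m x" using m[OF \<open>x \<in> Y\<close>] by simp
    have "\<bar>\<Sum>y\<in>Y. K x y * f y\<bar> \<le> (\<Sum>y\<in>Y. \<bar>K x y\<bar> * \<bar>f y\<bar>)"
      using sum_abs[of "\<lambda>y. K x y * f y" Y] by (simp add: abs_mult)
    then have "\<bar>\<Sum>y\<in>Y. K x y * f y\<bar> powr p \<le> (\<Sum>y\<in>Y. \<bar>K x y\<bar> * \<bar>f y\<bar>) powr p"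
      using \<open>p \<ge> 1\<close> by (intro powr_mono2) auto
    also have "\<dots> \<le> q powr (p - 1) * (\<Sum>y\<in>Y. \<bar>K x y\<bar> * \<bar>f y\<bar> powr p)"
      using rows[OF \<open>x \<in> Y\<close>] assms(1,2) by (intro powr_weighted_sum_le) auto
    finally show "\<bar>\<Sum>y\<in>Y. K x y * f y\<bar> powr p
        \<le> q powr (p - 1) * (\<Sum>y\<in>Y. \<bar>K x y\<bar> * \<bar>f y\<bar> powr p)" .
  qed
  also have "\<dots> = q powr (p - 1) * (\<Sum>x\<in>Y. \<Sum>y\<in>Y. (m x * \<bar>K x y\<bar>) * \<bar>f y\<bar> powr p)"
    by (simp add: sum_distrib_left mult_ac)
  also have "(\<Sum>x\<in>Y. \<Sum>y\<in>Y. (m x * \<bar>K x y\<bar>) * \<bar>f y\<bar> powr p)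
      = (\<Sum>x\<in>Y. \<Sum>y\<in>Y. (m y * \<bar>K y x\<bar>) * \<bar>f y\<bar> powr p)"
    by (intro sum.cong refl) (simp add: abs_sym)
  \<comment> \<open>With the roles of \<open>x\<close> and \<open>y\<close> exchanged in the kernel,
    swapping the sums leaves the absolute sum of row \<open>y\<close>, to which \<open>rows\<close>
    applies.\<close>
  also have "\<dots> = (\<Sum>y\<in>Y. m y * \<bar>f y\<bar> powr p * (\<Sum>x\<in>Y. \<bar>K y x\<bar>))"
    by (subst sum.swap) (simp add: sum_distrib_left mult_ac)
  also have "\<dots> \<le> (\<Sum>y\<in>Y. m y * \<bar>f y\<bar> powr p * q)"
    using m rows by (intro sum_mono mult_left_mono mult_nonneg_nonneg) (auto intro: less_imp_le)
  also have "q powr (p - 1) * \<dots> = q powr p * (\<Sum>y\<in>Y. m y * \<bar>f y\<bar> powr p)"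
    using \<open>q > 0\<close> by (simp add: powr_diff flip: sum_distrib_right)
  finally show ?thesis by (simp add: mult_left_mono)
qed

lemma lp_norm_infinity_le_iff:
  "lp_norm m \<infinity> f \<le> N \<longleftrightarrow> (\<forall>x. \<bar>f $ x\<bar> \<le> N)"
  by (auto simp: lp_norm_def)

lemma abs_nth_le_lp_norm_infinity: "\<bar>f $ x\<bar> \<le> lp_norm m \<infinity> f"
  using lp_norm_infinity_le_iff by blast

lemma lp_norm_infinity_nonneg: "0 \<le> lp_norm m \<infinity> f"
  using abs_ge_zero abs_nth_le_lp_norm_infinity order.trans by blast


subsection \<open>Semigroups of symmetric operators\<close>

text \<open>The properties shared by \<open>H\<close>, its multiples, the shifts
  \<open>c - H\<close> and the exponentials \<open>exp (- t H)\<close>, so that one set of lemmas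
  serves all of them.\<close>

locale symmetric_operator =
  fixes m :: "'a::finite \<Rightarrow> real" and Y :: "'a set" and A :: "real ^ 'a \<Rightarrow> real ^ 'a"
  assumes weight_pos: "0 < m x"
    and linear: "linear A"
    and symmetric: "weighted_inner m (A f) g = weighted_inner m f (A g)"
    and invariant: "f \<in> funs_on Y \<Longrightarrow> A f \<in> funs_on Y"
begin

section \<open>Matrix entries, row sums and weighted norms\<close>

lemma weighted_inner_ind:
  "weighted_inner m f (ind x) = f $ x * m x" "weighted_inner m (ind x) f = f $ x * m x"
  by (auto simp: weighted_inner_def axis_def if_distrib if_distribR cong: if_cong)

lemma funpow_symmetric: "weighted_inner m ((A ^^ n) f) g = weighted_inner m f ((A ^^ n) g)"
  by (induction n arbitrary: f g) (simp_all add: symmetric funpow_swap1)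

lemma funpow_invariant: "f \<in> funs_on Y \<Longrightarrow> (A ^^ n) f \<in> funs_on Y"
  by (induction n) (auto intro: invariant)

lemma ind_in_funs_on: "x \<in> Y \<Longrightarrow> ind x \<in> funs_on Y"
  by (auto simp: funs_on_def axis_def)

lemma entry_symmetric: "m x * A (ind y) $ x = m y * A (ind x) $ y"
  using symmetric[of "ind y" "ind x"] by (simp add: weighted_inner_ind mult.commute)

text \<open>Invariance of \<open>funs_on Y\<close> kills the transposed entry, and symmetry with
  positive weights carries this over.\<close>

lemma entry_outside:
  assumes "x \<in> Y" "y \<notin> Y"
  shows "A (ind y) $ x = 0"
proof -
  have "A (ind x) $ y = 0"
    using invariant[OF ind_in_funs_on[OF \<open>x \<in> Y\<close>]] \<open>y \<notin> Y\<close> by (simp add: funs_on_def)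
  then show ?thesis using entry_symmetric[of x y] weight_pos[of x] by simp
qed

lemma nth_expand_on:
  assumes "f \<in> funs_on Y"
  shows "A f $ x = (\<Sum>y\<in>Y. A (ind y) $ x * f $ y)"
  unfolding linear_nth_expand[OF linear, of f] using assms
  by (intro sum.mono_neutral_right) (auto simp: funs_on_def)

text \<open>Testing the supremum bound on the sign pattern of row \<open>x\<close> recovers the
  absolute row sum.\<close>

lemma row_sum_le:
  assumes bound: "\<And>f. f \<in> funs_on Y \<Longrightarrow> lp_norm m \<infinity> (A f) \<le> q * lp_norm m \<infinity> f"
    and "0 \<le> q"
  shows "(\<Sum>y\<in>Y. \<bar>A (ind y) $ x\<bar>) \<le> q"
proof -
  define f :: "real ^ 'a" where "f = (\<chi> y. if y \<in> Y then sgn (A (ind y) $ x) else 0)"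
  have f: "f \<in> funs_on Y" by (simp add: f_def funs_on_def)
  \<comment> \<open>Only an inequality: \<open>f\<close> is zero when the row vanishes on
    \<open>Y\<close>, and this is why \<open>0 \<le> q\<close> is assumed.\<close>
  have "lp_norm m \<infinity> f \<le> 1"
    unfolding lp_norm_infinity_le_iff by (auto simp: f_def abs_sgn_eq)
  have "(\<Sum>y\<in>Y. \<bar>A (ind y) $ x\<bar>) = A f $ x"
    unfolding nth_expand_on[OF f] by (intro sum.cong) (auto simp: f_def abs_sgn)
  also have "\<dots> \<le> lp_norm m \<infinity> (A f)"
    using abs_nth_le_lp_norm_infinity[of "A f" x m] by simp
  also have "\<dots> \<le> q * lp_norm m \<infinity> f" using bound[OF f] .
  also have "\<dots> \<le> q * 1" using \<open>lp_norm m \<infinity> f \<le> 1\<close> \<open>0 \<le> q\<close> by (rule mult_left_mono)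
  finally show ?thesis by simp
qed

text \<open>The supremum bound controls the row sums, the Schur test then bounds the sum of
  \<open>r\<close>-th powers, and taking the \<open>r\<close>-th root concludes.\<close>

lemma lp_norm_le_of_infinity:
  assumes bound: "\<And>f. f \<in> funs_on Y \<Longrightarrow> lp_norm m \<infinity> (A f) \<le> q * lp_norm m \<infinity> f"
    and "0 < q" and f: "f \<in> funs_on Y" and "1 \<le> p"
  shows "lp_norm m p (A f) \<le> q * lp_norm m p f"
proof (cases p)
  case (real r)
  then have "1 \<le> r" using \<open>1 \<le> p\<close> by simp
  have on_Y: "(\<Sum>x\<in>UNIV. m x * \<bar>g $ x\<bar> powr r) = (\<Sum>x\<in>Y. m x * \<bar>g $ x\<bar> powr r)"
    if "g \<in> funs_on Y" for g :: "real ^ 'a"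
    using that by (intro sum.mono_neutral_right) (auto simp: funs_on_def)
  have nonneg: "0 \<le> (\<Sum>x\<in>Y. m x * \<bar>g $ x\<bar> powr r)" for g :: "real ^ 'a"
    by (intro sum_nonneg mult_nonneg_nonneg less_imp_le[OF weight_pos]) simp
  have "(\<Sum>x\<in>Y. m x * \<bar>A f $ x\<bar> powr r) \<le> q powr r * (\<Sum>x\<in>Y. m x * \<bar>f $ x\<bar> powr r)"
    unfolding nth_expand_on[OF f]
    by (rule symmetric_kernel_powr_le)
      (auto intro: weight_pos entry_symmetric row_sum_le bound \<open>1 \<le> r\<close> \<open>0 < q\<close> less_imp_le)
  then have "(\<Sum>x\<in>Y. m x * \<bar>A f $ x\<bar> powr r) powr (1 / r)
      \<le> (q powr r * (\<Sum>x\<in>Y. m x * \<bar>f $ x\<bar> powr r)) powr (1 / r)"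
    using \<open>1 \<le> r\<close> nonneg by (intro powr_mono2) auto
  also have "\<dots> = q * (\<Sum>x\<in>Y. m x * \<bar>f $ x\<bar> powr r) powr (1 / r)"
    using \<open>1 \<le> r\<close> \<open>0 < q\<close> nonneg by (simp add: powr_mult powr_powr)
  finally show ?thesis
    using real by (simp add: lp_norm_def on_Y f invariant)
next
  case PInf
  then show ?thesis using bound[OF f] by simp
next
  case MInf
  then show ?thesis using \<open>1 \<le> p\<close> by simp
qed

section \<open>Closure under scaling and exponentials\<close>

lemma symmetric_operator_scaleR: "symmetric_operator m Y (\<lambda>g. t *\<^sub>R A g)"
proof (rule symmetric_operator.intro)
  show "linear (\<lambda>g. t *\<^sub>R A g)" by (intro linear_compose_scale_right linear)
  show "weighted_inner m (t *\<^sub>R A f) g = weighted_inner m f (t *\<^sub>R A g)" for f g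
    using arg_cong[OF symmetric[of f g], of "\<lambda>s. t * s"]
    by (simp add: weighted_inner_def sum_distrib_left mult_ac)
  show "t *\<^sub>R A f \<in> funs_on Y" if "f \<in> funs_on Y" for f
    using invariant[OF that] by (simp add: funs_on_def)
qed (rule weight_pos)

text \<open>Every power of \<open>A\<close> is symmetric and leaves \<open>funs_on Y\<close>
  invariant; both properties survive summation of the series.\<close>

lemma symmetric_operator_op_exp: "symmetric_operator m Y (op_exp A)"
proof (rule symmetric_operator.intro)
  show "linear (op_exp A)" by (rule linear_op_exp[OF linear])
  show "weighted_inner m (op_exp A f) g = weighted_inner m f (op_exp A g)" for f g
  proof -
    have "(\<lambda>n. \<Sum>x\<in>UNIV. (A ^^ n) f $ x / fact n * g $ x * m x) sums weighted_inner m (op_exp A f) g"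
      unfolding weighted_inner_def
      by (intro sums_sum sums_mult2 op_exp_nth_sums linear)
    moreover have
      "(\<lambda>n. \<Sum>x\<in>UNIV. f $ x * ((A ^^ n) g $ x / fact n) * m x) sums weighted_inner m f (op_exp A g)"
      unfolding weighted_inner_def
      by (intro sums_sum sums_mult2 sums_mult op_exp_nth_sums linear)
    moreover have "(\<Sum>x\<in>UNIV. (A ^^ n) f $ x / fact n * g $ x * m x)
        = (\<Sum>x\<in>UNIV. f $ x * ((A ^^ n) g $ x / fact n) * m x)" for n
      using arg_cong[OF funpow_symmetric[of n f g], of "\<lambda>s. s / fact n"]
      by (simp add: weighted_inner_def sum_divide_distrib)
    ultimately show ?thesis by (simp add: sums_iff)
  qed
  show "op_exp A f \<in> funs_on Y" if "f \<in> funs_on Y" for f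
    unfolding funs_on_def
  proof (intro CollectI allI impI)
    fix x assume "x \<notin> Y"
    then have "(A ^^ n) f $ x = 0" for n
      using funpow_invariant[OF that, of n] by (simp add: funs_on_def)
    then show "op_exp A f $ x = 0"
      using op_exp_nth_sums[OF linear, of f x] by (simp add: sums_iff)
  qed
qed (rule weight_pos)

text \<open>The \<open>n\<close>-th power has supremum norm at most \<open>q ^ n\<close> on
  \<open>funs_on Y\<close>, so the operator series is dominated by that of
  \<open>exp q\<close>.\<close>

lemma op_exp_infinity_le:
  assumes bound: "\<And>f. f \<in> funs_on Y \<Longrightarrow> lp_norm m \<infinity> (A f) \<le> q * lp_norm m \<infinity> f"
    and "0 \<le> q" and f: "f \<in> funs_on Y"
  shows "lp_norm m \<infinity> (op_exp A f) \<le> exp q * lp_norm m \<infinity> f"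
  unfolding lp_norm_infinity_le_iff
proof
  fix x
  define N where "N = lp_norm m \<infinity> f"
  have power_bound: "lp_norm m \<infinity> ((A ^^ n) f) \<le> q ^ n * N" for n
  proof (induction n)
    case (Suc n)
    have "lp_norm m \<infinity> ((A ^^ Suc n) f) \<le> q * lp_norm m \<infinity> ((A ^^ n) f)"
      using bound[OF funpow_invariant[OF f, of n]] by simp
    also have "\<dots> \<le> q * (q ^ n * N)" using Suc \<open>0 \<le> q\<close> by (rule mult_left_mono)
    finally show ?case by (simp add: mult.assoc)
  qed (simp add: N_def)
  have sums: "(\<lambda>n. q ^ n / fact n * N) sums (exp q * N)"
    using sums_mult2[OF exp_converges[of q], of N] by (simp add: divide_inverse mult_ac)
  have "\<bar>(A ^^ n) f $ x / fact n\<bar> \<le> q ^ n / fact n * N" for n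
    using order.trans[OF abs_nth_le_lp_norm_infinity power_bound, of n x] by (simp add: divide_simps)
  then have "norm (\<Sum>n. (A ^^ n) f $ x / fact n) \<le> (\<Sum>n. q ^ n / fact n * N)"
    by (intro norm_suminf_le sums_summable[OF sums]) simp
  then show "\<bar>op_exp A f $ x\<bar> \<le> exp q * lp_norm m \<infinity> f"
    using sums op_exp_nth_sums[OF linear, of f x] by (simp add: sums_iff N_def)
qed

section \<open>Dominance and supremum contraction\<close>

lemma dominant_imp_semigroup_infinity_le:
  assumes dom: "\<And>x. x \<in> Y \<Longrightarrow> R + (\<Sum>y\<in>Y - {x}. \<bar>A (ind y) $ x\<bar>) \<le> A (ind x) $ x"
    and "0 \<le> t" and f: "f \<in> funs_on Y"
  shows "lp_norm m \<infinity> (op_exp (\<lambda>g. - t *\<^sub>R A g) f) \<le> exp (- R * t) * lp_norm m \<infinity> f"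
proof -
  \<comment> \<open>Large enough to exceed every diagonal entry, so that the diagonal of
    \<open>c - A\<close> is nonnegative, and also \<open>R\<close>, so that \<open>c - R\<close> can
    serve as a norm bound.\<close>
  define c where "c = \<bar>R\<bar> + (\<Sum>x\<in>UNIV. \<bar>A (ind x) $ x\<bar>)"
  have diag: "A (ind x) $ x \<le> c" for x
    using member_le_sum[of x UNIV "\<lambda>x. \<bar>A (ind x) $ x\<bar>"] by (simp add: c_def)
  have "R \<le> c" by (simp add: c_def sum_nonneg add_increasing2)
  define B where "B = (\<lambda>g. c *\<^sub>R g - A g)"
  interpret B: symmetric_operator m Y B
  proof (rule symmetric_operator.intro)
    show "linear B"
      unfolding B_def by (intro linear_compose_sub linear linear_compose_scale_right linear_ident)
    show "weighted_inner m (B f) g = weighted_inner m f (B g)" for f g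
      using symmetric[of f g]
      by (simp add: B_def weighted_inner_def algebra_simps sum.distrib sum_subtractf)
    show "B f \<in> funs_on Y" if "f \<in> funs_on Y" for f
      using that invariant[OF that] by (simp add: B_def funs_on_def)
  qed (rule weight_pos)
  have bound: "lp_norm m \<infinity> (B g) \<le> (c - R) * lp_norm m \<infinity> g" if g: "g \<in> funs_on Y" for g
    unfolding lp_norm_infinity_le_iff
  proof
    fix x
    define N where "N = lp_norm m \<infinity> g"
    have N: "\<bar>g $ y\<bar> \<le> N" for y
      unfolding N_def by (rule abs_nth_le_lp_norm_infinity)
    show "\<bar>B g $ x\<bar> \<le> (c - R) * lp_norm m \<infinity> g"
    proof (cases "x \<in> Y")
      case False
      then show ?thesis
        using B.invariant[OF g] \<open>R \<le> c\<close> lp_norm_infinity_nonneg[of m g] by (simp add: funs_on_def)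
    next
      case True
      have "B g $ x = (c - A (ind x) $ x) * g $ x - (\<Sum>y\<in>Y - {x}. A (ind y) $ x * g $ y)"
        by (simp add: B_def nth_expand_on[OF g] sum.remove[OF _ True] algebra_simps)
      also have "\<bar>\<dots>\<bar> \<le> \<bar>(c - A (ind x) $ x) * g $ x\<bar> + (\<Sum>y\<in>Y - {x}. \<bar>A (ind y) $ x * g $ y\<bar>)"
        by (intro order.trans[OF abs_triangle_ineq4] add_left_mono sum_abs)
      \<comment> \<open>The diagonal coefficient is nonnegative by \<open>diag\<close>, so its
        absolute value disappears and \<open>- A (ind x) $ x\<close> remains available for
        \<open>dom\<close>.\<close>
      also have "\<dots> \<le> (c - A (ind x) $ x) * N + (\<Sum>y\<in>Y - {x}. \<bar>A (ind y) $ x\<bar> * N)"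
        using N diag[of x] unfolding abs_mult by (intro add_mono sum_mono mult_mono) auto
      also have "\<dots> = (c - A (ind x) $ x + (\<Sum>y\<in>Y - {x}. \<bar>A (ind y) $ x\<bar>)) * N"
        by (simp add: algebra_simps sum_distrib_left)
      also have "\<dots> \<le> (c - R) * N"
        using dom[OF True] lp_norm_infinity_nonneg[of m g]
        by (intro mult_right_mono) (auto simp: N_def)
      finally show ?thesis by (simp add: N_def)
    qed
  qed
  interpret tB: symmetric_operator m Y "\<lambda>g. t *\<^sub>R B g"
    by (rule B.symmetric_operator_scaleR)
  have scaled: "lp_norm m \<infinity> (t *\<^sub>R B g) \<le> t * (c - R) * lp_norm m \<infinity> g" if "g \<in> funs_on Y" for g
  proof -
    have "\<bar>B g $ x\<bar> \<le> (c - R) * lp_norm m \<infinity> g" for x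
      using bound[OF that] by (simp add: lp_norm_infinity_le_iff)
    then show ?thesis
      using \<open>0 \<le> t\<close> by (auto simp: lp_norm_infinity_le_iff abs_mult mult.assoc intro: mult_left_mono)
  qed
  \<comment> \<open>Since \<open>- t A = - t c + t B\<close>, the scalar part factors out, and
    \<open>exp (- t c)\<close> times the bound \<open>exp (t (c - R))\<close> is
    \<open>exp (- R t)\<close>.\<close>
  have "op_exp (\<lambda>g. - t *\<^sub>R A g) f = op_exp (\<lambda>g. (- t * c) *\<^sub>R g + t *\<^sub>R B g) f"
    by (simp add: B_def algebra_simps)
  also have "\<dots> = exp (- t * c) *\<^sub>R op_exp (\<lambda>g. t *\<^sub>R B g) f"
    by (rule op_exp_add_scaleR[OF tB.linear])
  finally have eq: "op_exp (\<lambda>g. - t *\<^sub>R A g) f = exp (- t * c) *\<^sub>R op_exp (\<lambda>g. t *\<^sub>R B g) f" .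
  have "lp_norm m \<infinity> (op_exp (\<lambda>g. t *\<^sub>R B g) f) \<le> exp (t * (c - R)) * lp_norm m \<infinity> f"
    using \<open>0 \<le> t\<close> \<open>R \<le> c\<close> by (intro tB.op_exp_infinity_le scaled f) auto
  then have "exp (- t * c) * \<bar>op_exp (\<lambda>g. t *\<^sub>R B g) f $ x\<bar>
      \<le> exp (- t * c) * (exp (t * (c - R)) * lp_norm m \<infinity> f)" for x
    by (intro mult_left_mono) (simp_all add: lp_norm_infinity_le_iff)
  then show ?thesis
    unfolding eq lp_norm_infinity_le_iff
    by (simp add: abs_mult algebra_simps flip: mult.assoc exp_add)
qed

lemma semigroup_infinity_le_imp_dominant:
  assumes contr: "\<And>f t. f \<in> funs_on Y \<Longrightarrow> 0 \<le> t \<Longrightarrow>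
      lp_norm m \<infinity> (op_exp (\<lambda>g. - t *\<^sub>R A g) f) \<le> exp (- R * t) * lp_norm m \<infinity> f"
    and "x \<in> Y"
  shows "R + (\<Sum>y\<in>Y - {x}. \<bar>A (ind y) $ x\<bar>) \<le> A (ind x) $ x"
proof -
  \<comment> \<open>The extremal test function: value 1 at \<open>x\<close> and signs opposite to
    the row elsewhere, so that \<open>A f $ x\<close> is the diagonal entry minus the absolute
    off-diagonal sum.\<close>
  define f :: "real ^ 'a" where
    "f = (\<chi> y. if y = x then 1 else if y \<in> Y then - sgn (A (ind y) $ x) else 0)"
  have f: "f \<in> funs_on Y" using \<open>x \<in> Y\<close> by (auto simp: f_def funs_on_def)
  have norm_f: "lp_norm m \<infinity> f \<le> 1"
    unfolding lp_norm_infinity_le_iff by (auto simp: f_def abs_sgn_eq)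
  have Af: "A f $ x = A (ind x) $ x - (\<Sum>y\<in>Y - {x}. \<bar>A (ind y) $ x\<bar>)"
  proof -
    have "(\<Sum>y\<in>Y - {x}. A (ind y) $ x * f $ y) = - (\<Sum>y\<in>Y - {x}. \<bar>A (ind y) $ x\<bar>)"
      unfolding sum_negf[symmetric] by (intro sum.cong) (auto simp: f_def abs_sgn)
    moreover have "f $ x = 1" by (simp add: f_def)
    ultimately show ?thesis
      by (simp add: nth_expand_on[OF f] sum.remove[OF _ \<open>x \<in> Y\<close>])
  qed
  define c where "c n = (A ^^ n) f $ x / fact n" for n
  define v where "v s = (\<Sum>n. c n * s ^ n)" for s
  have sums: "(\<lambda>n. c n * s ^ n) sums (op_exp (\<lambda>g. s *\<^sub>R A g) f $ x)" for s
    unfolding c_def by (rule op_exp_scaleR_nth_sums[OF linear])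
  then have v_eq: "v s = op_exp (\<lambda>g. s *\<^sub>R A g) f $ x" for s
    by (simp add: v_def sums_iff)
  have v0: "v 0 = 1"
    unfolding v_def powser_zero by (simp add: c_def f_def)
  \<comment> \<open>The derivative at 0 is the coefficient \<open>c 1\<close>.\<close>
  have "(\<Sum>n. diffs c n * 0 ^ n) = A f $ x"
    unfolding powser_zero by (simp add: diffs_def c_def)
  then have "(v has_real_derivative A f $ x) (at 0)"
    using termdiffs_strong_converges_everywhere[OF sums_summable[OF sums], of 0]
    unfolding v_def[abs_def] by simp
  then have v': "((\<lambda>t. v (- t)) has_real_derivative - A f $ x) (at 0)"
    using DERIV_mirror[of v "A f $ x" 0] by simp
  \<comment> \<open>Both functions equal 1 at 0. If \<open>A f $ x < R\<close>, their difference is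
    increasing there, so \<open>v (- h)\<close> exceeds \<open>exp (- R * h)\<close> for small
    positive \<open>h\<close>, against the contraction and \<open>norm_f\<close>.\<close>
  have deriv: "((\<lambda>t. v (- t) - exp (- R * t)) has_real_derivative (R - A f $ x)) (at 0)"
    by (rule derivative_eq_intros v' refl | simp)+
  have "R \<le> A f $ x"
  proof (rule ccontr)
    assume "\<not> R \<le> A f $ x"
    then obtain d where "0 < d" and d: "\<And>h. 0 < h \<Longrightarrow> h < d \<Longrightarrow> exp (- R * h) < v (- h)"
      using DERIV_pos_inc_right[OF deriv] by (auto simp: v0)
    have "v (- (d / 2)) \<le> lp_norm m \<infinity> (op_exp (\<lambda>g. - (d / 2) *\<^sub>R A g) f)"
      unfolding v_eq using abs_nth_le_lp_norm_infinity[of _ x m] abs_le_D1 by blast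
    also have "\<dots> \<le> exp (- R * (d / 2)) * lp_norm m \<infinity> f"
      using \<open>0 < d\<close> by (intro contr f) simp
    also have "\<dots> \<le> exp (- R * (d / 2)) * 1"
      using norm_f by (intro mult_left_mono) auto
    finally show False using d[of "d / 2"] \<open>0 < d\<close> by simp
  qed
  then show ?thesis by (simp add: Af)
qed

text \<open>Subtracting \<open>R\<close> changes only the diagonal entries, and selfadjointness is
  automatic in this locale.\<close>

lemma diagonally_dominant_on_shift_iff:
  "diagonally_dominant_on m Y (\<lambda>f. A f - R *\<^sub>R f) \<longleftrightarrow>
    (\<forall>x\<in>Y. R + (\<Sum>y\<in>Y - {x}. \<bar>A (ind y) $ x\<bar>) \<le> A (ind x) $ x)"
proof -
  have "selfadjoint_on m Y (\<lambda>f. A f - R *\<^sub>R f)"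
    unfolding selfadjoint_on_def
  proof (intro conjI ballI allI)
    fix f g :: "real ^ 'a" and c :: real
    show "A f - R *\<^sub>R f \<in> funs_on Y" if "f \<in> funs_on Y"
      using that invariant[OF that] by (simp add: funs_on_def)
    show "A (f + g) - R *\<^sub>R (f + g) = A f - R *\<^sub>R f + (A g - R *\<^sub>R g)"
      by (simp add: linear_add[OF linear] algebra_simps)
    show "A (c *\<^sub>R f) - R *\<^sub>R c *\<^sub>R f = c *\<^sub>R (A f - R *\<^sub>R f)"
      by (simp add: linear_cmul[OF linear] algebra_simps)
    show "weighted_inner m (A f - R *\<^sub>R f) g = weighted_inner m f (A g - R *\<^sub>R g)"
      using symmetric[of f g] by (simp add: weighted_inner_def algebra_simps sum_subtractf)
  qed
  moreover have "(\<Sum>y\<in>Y - {x}. \<bar>(A (ind y) - R *\<^sub>R ind y) $ x\<bar>) = (\<Sum>y\<in>Y - {x}. \<bar>A (ind y) $ x\<bar>)"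
    for x by (intro sum.cong) (auto simp: axis_def)
  ultimately show ?thesis
    by (auto simp: diagonally_dominant_on_def algebra_simps)
qed

end


subsection \<open>The Hodge Laplacian\<close>

context cell_complex
begin

text \<open>Testing the adjoint relation against \<open>ind x\<close> determines the operator behind
  the choice in \<open>weighted_adjoint\<close>; linearity and the effect on dimensions are read off
  from this formula.\<close>

lemma weighted_adjoint_nth:
  "weighted_adjoint m \<delta> f $ x = (\<Sum>z\<in>UNIV. \<delta> (ind x) $ z * f $ z * m z) / m x"
proof -
  have "weighted_inner m (\<delta> (ind x)) f = weighted_inner m (ind x) (weighted_adjoint m \<delta> f)"
    using linear_coboundary weight_pos by (rule weighted_adjoint_works)
  also have "\<dots> = weighted_adjoint m \<delta> f $ x * m x"
    by (auto simp: weighted_inner_def axis_def if_distrib if_distribR cong: if_cong)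
  finally show ?thesis
    using weight_pos[of x] by (simp add: weighted_inner_def field_simps)
qed

lemma linear_weighted_adjoint: "linear (weighted_adjoint m \<delta>)"
  by (rule linearI)
    (simp_all add: vec_eq_iff weighted_adjoint_nth algebra_simps sum.distrib add_divide_distrib
      sum_distrib_left)

lemma coboundary_in_cells:
  assumes "f \<in> funs_on (cells cdim k)"
  shows "\<delta> f \<in> funs_on (cells cdim (Suc k))"
  unfolding funs_on_def
proof (intro CollectI allI impI)
  fix z assume "z \<notin> cells cdim (Suc k)"
  then have "\<delta> (ind y) $ z * f $ y = 0" for y
    using assms incidence_dim[of z y] by (cases "cdim y = k") (auto simp: funs_on_def cells_def)
  then show "\<delta> f $ z = 0"
    unfolding linear_nth_expand[OF linear_coboundary, of f] by (intro sum.neutral) blast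
qed

text \<open>The adjoint lowers the dimension by one. The condition
  \<open>cdim x + 1 \<noteq> k\<close> avoids subtraction and holds for all \<open>x\<close> when
  \<open>k = 0\<close>, where the adjoint therefore vanishes.\<close>

lemma adjoint_in_cells:
  assumes "f \<in> funs_on (cells cdim k)" "cdim x + 1 \<noteq> k"
  shows "weighted_adjoint m \<delta> f $ x = 0"
proof -
  have "\<delta> (ind x) $ z * f $ z = 0" for z
    using assms incidence_dim[of z x] by (cases "cdim z = k") (auto simp: funs_on_def cells_def)
  then have "(\<Sum>z\<in>UNIV. \<delta> (ind x) $ z * f $ z * m z) = 0" by (intro sum.neutral) simp
  then show ?thesis by (simp add: weighted_adjoint_nth)
qed

lemma hodge_laplacian_in_cells:
  assumes "f \<in> funs_on (cells cdim k)"
  shows "hodge_laplacian \<delta> m f \<in> funs_on (cells cdim k)"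
proof -
  have "weighted_adjoint m \<delta> (\<delta> f) \<in> funs_on (cells cdim k)"
    using adjoint_in_cells[OF coboundary_in_cells[OF assms]] by (auto simp: funs_on_def cells_def)
  moreover have "\<delta> (weighted_adjoint m \<delta> f) \<in> funs_on (cells cdim k)"
  proof (cases k)
    case 0
    then have "weighted_adjoint m \<delta> f = 0"
      using adjoint_in_cells[OF assms] by (simp add: vec_eq_iff)
    then show ?thesis by (simp add: linear_0[OF linear_coboundary] funs_on_def)
  next
    case (Suc j)
    have "weighted_adjoint m \<delta> f \<in> funs_on (cells cdim j)"
      using adjoint_in_cells[OF assms] Suc by (auto simp: funs_on_def cells_def)
    then show ?thesis using coboundary_in_cells Suc by simp
  qed
  ultimately show ?thesis by (simp add: hodge_laplacian_def funs_on_def)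
qed

lemma symmetric_operator_hodge_laplacian:
  "symmetric_operator m (cells cdim k) (hodge_laplacian \<delta> m)"
proof (rule symmetric_operator.intro)
  let ?d = "weighted_adjoint m \<delta>"
  have adj: "weighted_inner m (\<delta> f) g = weighted_inner m f (?d g)" for f g
    using linear_coboundary weight_pos by (rule weighted_adjoint_works)
  have commute: "weighted_inner m f g = weighted_inner m g f" for f g
    by (simp add: weighted_inner_def mult_ac)
  have add: "weighted_inner m (f + g) h = weighted_inner m f h + weighted_inner m g h" for f g h
    by (simp add: weighted_inner_def algebra_simps sum.distrib)
  show "linear (hodge_laplacian \<delta> m)"
    unfolding hodge_laplacian_def[abs_def]
    using linear_compose_add[OF linear_compose[OF linear_weighted_adjoint linear_coboundary]
        linear_compose[OF linear_coboundary linear_weighted_adjoint]]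
    by (simp add: o_def)
  \<comment> \<open>Moving one factor of each summand across turns the Laplacian into a form that is
    visibly symmetric in \<open>f\<close> and \<open>g\<close>.\<close>
  have form: "weighted_inner m (hodge_laplacian \<delta> m f) g =
      weighted_inner m (?d f) (?d g) + weighted_inner m (\<delta> f) (\<delta> g)" for f g
    unfolding hodge_laplacian_def add adj commute[of "?d (\<delta> f)"]
    by (simp flip: adj add: commute)
  show "weighted_inner m (hodge_laplacian \<delta> m f) g = weighted_inner m f (hodge_laplacian \<delta> m g)"
    for f g
    unfolding commute[of f] form by (simp add: commute)
  show "hodge_laplacian \<delta> m f \<in> funs_on (cells cdim k)" if "f \<in> funs_on (cells cdim k)" for f
    by (rule hodge_laplacian_in_cells[OF that])
qed (rule weight_pos)

text \<open>Cells of other dimensions contribute zero entries, so the sum over all cells in the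
  curvature reduces to the one in diagonal dominance.\<close>

lemma forman_curvature_on_cells:
  assumes "x \<in> cells cdim k"
  shows "forman_curvature \<delta> m x = hodge_laplacian \<delta> m (ind x) $ x -
    (\<Sum>y\<in>cells cdim k - {x}. \<bar>hodge_laplacian \<delta> m (ind y) $ x\<bar>)"
proof -
  interpret symmetric_operator m "cells cdim k" "hodge_laplacian \<delta> m"
    by (rule symmetric_operator_hodge_laplacian)
  have "(\<Sum>y\<in>UNIV - {x}. \<bar>hodge_laplacian \<delta> m (ind y) $ x\<bar>) =
      (\<Sum>y\<in>cells cdim k - {x}. \<bar>hodge_laplacian \<delta> m (ind y) $ x\<bar>)"
    by (intro sum.mono_neutral_right) (use entry_outside[OF assms] in auto)
  then show ?thesis by (simp add: forman_curvature_def)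
qed

end

section \<open>Equivalence of the four statements\<close>

theorem theorem4p1:
  fixes cdim :: "'a::finite \<Rightarrow> nat"
    and \<delta> :: "real ^ 'a \<Rightarrow> real ^ 'a"
    and m :: "'a \<Rightarrow> real"
    and k :: nat
    and R :: real
  assumes "cell_complex cdim \<delta> m"
    and "k \<ge> 1"
  defines "H \<equiv> hodge_laplacian \<delta> m"
  defines "curv \<equiv> (\<forall>x\<in>cells cdim k. forman_curvature \<delta> m x \<ge> R)"
    and "contr_inf \<equiv> (\<forall>f\<in>funs_on (cells cdim k). \<forall>t\<ge>0.
           lp_norm m \<infinity> (op_exp (\<lambda>g. - t *\<^sub>R H g) f) \<le> exp (- R * t) * lp_norm m \<infinity> f)"
    and "contr_p \<equiv> (\<forall>f\<in>funs_on (cells cdim k). \<forall>p::ereal. 1 \<le> p \<longrightarrow> (\<forall>t\<ge>0.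
           lp_norm m p (op_exp (\<lambda>g. - t *\<^sub>R H g) f) \<le> exp (- R * t) * lp_norm m p f))"
    and "dd \<equiv> diagonally_dominant_on m (cells cdim k) (\<lambda>f. H f - R *\<^sub>R f)"
  shows "(curv \<longleftrightarrow> contr_inf) \<and> (contr_inf \<longleftrightarrow> contr_p) \<and> (contr_p \<longleftrightarrow> dd)"
proof -
  interpret cell_complex cdim \<delta> m by (rule assms(1))
  interpret H: symmetric_operator m "cells cdim k" H
    unfolding H_def by (rule symmetric_operator_hodge_laplacian)
  \<comment> \<open>The common entrywise form of the curvature bound and of diagonal dominance,
    serving as the hub of the equivalences.\<close>
  define dominant where "dominant \<longleftrightarrow>
    (\<forall>x\<in>cells cdim k. R + (\<Sum>y\<in>cells cdim k - {x}. \<bar>H (ind y) $ x\<bar>) \<le> H (ind x) $ x)"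
  have "dd \<longleftrightarrow> dominant"
    unfolding dd_def dominant_def by (rule H.diagonally_dominant_on_shift_iff)
  moreover have "curv \<longleftrightarrow> dominant"
    unfolding curv_def dominant_def H_def
    by (intro ball_cong refl) (auto simp: forman_curvature_on_cells)
  moreover have "contr_inf" if dominant
    using that unfolding contr_inf_def dominant_def
    by (blast intro: H.dominant_imp_semigroup_infinity_le)
  moreover have "dominant" if contr_inf
    using that unfolding contr_inf_def dominant_def
    by (blast intro: H.semigroup_infinity_le_imp_dominant)
  moreover have "contr_p" if contr_inf
    unfolding contr_p_def
  proof (intro ballI allI impI)
    fix f and p :: ereal and t :: real
    assume f: "f \<in> funs_on (cells cdim k)" and "1 \<le> p" "0 \<le> t"
    interpret tH: symmetric_operator m "cells cdim k" "\<lambda>g. - t *\<^sub>R H g"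
      by (rule H.symmetric_operator_scaleR)
    interpret E: symmetric_operator m "cells cdim k" "op_exp (\<lambda>g. - t *\<^sub>R H g)"
      by (rule tH.symmetric_operator_op_exp)
    show "lp_norm m p (op_exp (\<lambda>g. - t *\<^sub>R H g) f) \<le> exp (- R * t) * lp_norm m p f"
    proof (rule E.lp_norm_le_of_infinity[OF _ exp_gt_zero f \<open>1 \<le> p\<close>])
      show "lp_norm m \<infinity> (op_exp (\<lambda>g. - t *\<^sub>R H g) g) \<le> exp (- R * t) * lp_norm m \<infinity> g"
        if "g \<in> funs_on (cells cdim k)" for g
        using \<open>contr_inf\<close> \<open>0 \<le> t\<close> that unfolding contr_inf_def by blast
    qed
  qed
  \<comment> \<open>The range of \<open>p\<close> includes \<open>\<infinity>\<close>, so this is a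
    special case.\<close>
  moreover have "contr_inf" if contr_p
    using that unfolding contr_p_def contr_inf_def by simp
  ultimately show ?thesis by blast
qed

end
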